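(* For $n\ge1$, the correspondence $R\mapsto T(R)$ is a bijection between the set of regions of the homogenized Linial arrangement $\mathcal{H}_{2n-2}$ and the set of alternation acyclic tournaments on $\{1,\ldots,n\}$.
   Context: Let $U_{2n-2}=\{(x_1,\ldots,x_n,y_1,\ldots,y_{n-1})\in\mathbb{R}^{2n-1}: x_1+\cdots+x_n=0\}$. The homogenized Linial arrangement $\mathcal{H}_{2n-2}$ is the set of hyperplanes $x_i-x_j=y_i$ ($1\le i<j\le n$) in $U_{2n-2}$; its regions are the connected components of the complement of their union in $U_{2n-2}$. For a region $R$, $T(R)$ is the tournament on $\{1,\ldots,n\}$ where, for each $i<j$, $i\to j$ if $x_i-y_i>x_j$ on $R$ and $j\to i$ if $x_i-y_i<x_j$ on $R$. A tournament on $\{1,\ldots,n\}$ has, for each pair $i\ne j$, exactly one of the arcs $i\to j$, $j\to i$; an arc $i\to j$ is an ascent if $i<j$, a descent if $i>j$; a tournament is alternation acyclic if it has no directed cycle along which ascents and descents alternate. *)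

theory Defs
  imports "HOL-Analysis.Analysis"
begin

text \<open>
  A point \<open>(x\<^sub>1, \<dots>, x\<^sub>n, y\<^sub>1, \<dots>, y\<^sub>n\<^sub>-\<^sub>1)\<close> of \<open>2n-1\<close>-dimensional real space is an element of
  \<^term>\<open>topspace (Euclidean_space (2 * n - 1))\<close>, whose coordinates are numbered from 0:
  first \<open>x\<^sub>1, \<dots>, x\<^sub>n\<close> in positions \<open>0, \<dots>, n-1\<close>, then \<open>y\<^sub>1, \<dots>, y\<^sub>n\<^sub>-\<^sub>1\<close> in positions \<open>n, \<dots>, 2n-2\<close>.
\<close>

definition x_coord :: "(nat \<Rightarrow> real) \<Rightarrow> nat \<Rightarrow> real"
  where "x_coord p i = p (i - 1)"

definition y_coord :: "nat \<Rightarrow> (nat \<Rightarrow> real) \<Rightarrow> nat \<Rightarrow> real"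
  where "y_coord n p i = p (n + i - 1)"

definition U_space :: "nat \<Rightarrow> (nat \<Rightarrow> real) set"
  where "U_space n = {p \<in> topspace (Euclidean_space (2 * n - 1)). (\<Sum>i = 1..n. x_coord p i) = 0}"

definition linial_hyperplane :: "nat \<Rightarrow> nat \<Rightarrow> nat \<Rightarrow> (nat \<Rightarrow> real) set"
  where "linial_hyperplane n i j = {p \<in> U_space n. x_coord p i - x_coord p j = y_coord n p i}"

definition homogenized_linial_arrangement :: "nat \<Rightarrow> (nat \<Rightarrow> real) set set"
  where "homogenized_linial_arrangement n = {linial_hyperplane n i j | i j. 1 \<le> i \<and> i < j \<and> j \<le> n}"

definition regions :: "nat \<Rightarrow> (nat \<Rightarrow> real) set set"
  where "regions n =
    connected_components_of
      (subtopology (Euclidean_space (2 * n - 1))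
        (U_space n - \<Union> (homogenized_linial_arrangement n)))"

text \<open>
  A tournament is given by its set of arcs; \<open>(i, j) \<in> T\<close> stands for \<open>i \<rightarrow> j\<close>.
\<close>

definition tournament :: "nat \<Rightarrow> (nat \<times> nat) set \<Rightarrow> bool"
  where "tournament n T \<longleftrightarrow>
    T \<subseteq> {(i, j). i \<in> {1..n} \<and> j \<in> {1..n} \<and> i \<noteq> j} \<and>
    (\<forall>i\<in>{1..n}. \<forall>j\<in>{1..n}. i \<noteq> j \<longrightarrow> ((i, j) \<in> T \<longleftrightarrow> (j, i) \<notin> T))"

definition ascent :: "nat \<times> nat \<Rightarrow> bool"
  where "ascent a \<longleftrightarrow> fst a < snd a"

definition descent :: "nat \<times> nat \<Rightarrow> bool"
  where "descent a \<longleftrightarrow> fst a > snd a"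

text \<open>
  The cycle \<open>c\<^sub>0 \<rightarrow> c\<^sub>1 \<rightarrow> \<dots> \<rightarrow> c\<^sub>k\<^sub>-\<^sub>1 \<rightarrow> c\<^sub>0\<close> is the list of its pairwise distinct vertices, and
  \<open>cycle_arc c i\<close> is its arc leaving \<open>c\<^sub>i\<close>, indices being read modulo the length \<open>k\<close>.
\<close>

definition cycle_arc :: "nat list \<Rightarrow> nat \<Rightarrow> nat \<times> nat"
  where "cycle_arc c i = (c ! (i mod length c), c ! (Suc i mod length c))"

definition directed_cycle :: "(nat \<times> nat) set \<Rightarrow> nat list \<Rightarrow> bool"
  where "directed_cycle T c \<longleftrightarrow>
    c \<noteq> [] \<and> distinct c \<and> (\<forall>i < length c. cycle_arc c i \<in> T)"

text \<open>
  Alternation is required cyclically: the last arc is also compared with the first one.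
\<close>

definition alternating :: "nat list \<Rightarrow> bool"
  where "alternating c \<longleftrightarrow>
    (\<forall>i < length c.
      ascent (cycle_arc c i) \<and> descent (cycle_arc c (Suc i)) \<or>
      descent (cycle_arc c i) \<and> ascent (cycle_arc c (Suc i)))"

definition alternation_acyclic :: "(nat \<times> nat) set \<Rightarrow> bool"
  where "alternation_acyclic T \<longleftrightarrow> (\<nexists>c. directed_cycle T c \<and> alternating c)"

definition region_tournament :: "nat \<Rightarrow> (nat \<Rightarrow> real) set \<Rightarrow> (nat \<times> nat) set"
  where "region_tournament n R =
    {(i, j) | i j. 1 \<le> i \<and> i < j \<and> j \<le> n \<and> (\<forall>p\<in>R. x_coord p i - y_coord n p i > x_coord p j)} \<union>
    {(j, i) | i j. 1 \<le> i \<and> i < j \<and> j \<le> n \<and> (\<forall>p\<in>R. x_coord p i - y_coord n p i < x_coord p j)}"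

end

theory Submission
  imports Defs
begin

text \<open>
  Put \<open>z\<^sub>i = x\<^sub>i - y\<^sub>i\<close>. An arc between \<open>i < j\<close> records the sign of \<open>z\<^sub>i - x\<^sub>j\<close>, so the regions are
  the nonempty (convex) sets of solutions of the sign conditions, one for each realizable tournament.
  Along an alternating cycle the numbers \<open>z\<close> (at the start of ascents) and \<open>x\<close> (at the start of
  descents) would keep decreasing, so realizable tournaments are alternation acyclic.
  Conversely, \<open>z\<^sub>n, z\<^sub>n\<^sub>-\<^sub>1, \<dots>\<close> can be placed one after the other: when \<open>z\<^sub>m\<close> is added, all
  \<open>x\<^sub>j\<close> with \<open>m \<rightarrow> j\<close> are shifted down, together with every \<open>z\<^sub>c\<close> that has no \<open>x\<^sub>j\<close> with
  \<open>j \<rightarrow> m\<close> below it. This destroys an earlier condition only if there is an alternating 4-cycle through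
  \<open>m\<close>.
\<close>

section \<open>Regions as connected components of the complement\<close>

definition compl_space :: "nat \<Rightarrow> (nat \<Rightarrow> real) set"
  where "compl_space n = U_space n - \<Union> (homogenized_linial_arrangement n)"

text \<open>\<open>Euclidean_space\<close> is the subspace of the product space where the
  coordinates from \<open>2 * n - 1\<close> on vanish, and the complement lies inside it. Components
  may therefore be taken in the function type itself, where \<open>connected\<close> and
  \<open>continuous_on\<close> apply.\<close>

lemma regions_eq: "regions n = connected_components_of (top_of_set (compl_space n))"
proof -
  have "compl_space n \<subseteq> {x. \<forall>i\<ge>2 * n - 1. x i = 0}"
    by (auto simp: compl_space_def U_space_def topspace_Euclidean_space)
  then show ?thesis
    unfolding regions_def Euclidean_space_def compl_space_def[symmetric]
    by (simp add: euclidean_product_topology subtopology_subtopology inf.absorb2)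
qed

lemma region_nonempty: "R \<in> regions n \<Longrightarrow> R \<noteq> {}"
  by (simp add: regions_eq nonempty_connected_components_of)

lemma region_subset: "R \<in> regions n \<Longrightarrow> R \<subseteq> compl_space n"
  unfolding regions_eq by (drule connected_components_of_subset) simp

lemma region_connected: "R \<in> regions n \<Longrightarrow> connected R"
  unfolding regions_eq
  by (drule connectedin_connected_components_of) (simp add: connectedin_subtopology)

lemma ex_region:
  assumes "p \<in> compl_space n"
  shows "\<exists>R\<in>regions n. p \<in> R"
proof -
  have "p \<in> \<Union> (connected_components_of (top_of_set (compl_space n)))"
    by (simp add: Union_connected_components_of assms)
  then show ?thesis by (auto simp: regions_eq)
qed

text \<open>By maximality a component that meets a connected subset \<open>C\<close> contains it;
  two components that both contain \<open>C\<close> overlap and so coincide.\<close>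

lemma regions_eqI:
  assumes "R \<in> regions n" "S \<in> regions n" "p \<in> R" "q \<in> S"
    and "connected C" "C \<subseteq> compl_space n" "p \<in> C" "q \<in> C"
  shows "R = S"
proof -
  have C: "connectedin (top_of_set (compl_space n)) C"
    by (simp add: connectedin_subtopology assms)
  have "C \<subseteq> R"
    by (rule connected_components_of_maximal[OF _ C])
      (use assms in \<open>auto simp: regions_eq disjnt_def\<close>)
  moreover have "C \<subseteq> S"
    by (rule connected_components_of_maximal[OF _ C])
      (use assms in \<open>auto simp: regions_eq disjnt_def\<close>)
  ultimately have "\<not> disjnt R S"
    using assms by (auto simp: disjnt_def)
  then show ?thesis
    using assms pairwise_disjoint_connected_components_of[of "top_of_set (compl_space n)"]
    by (auto simp: regions_eq pairwise_def)
qed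

text \<open>Rearranging the hyperplane equation puts the one combination x_i - y_i, which depends on
  \<open>i\<close> only, against x_j. All later arguments compare these two families of
  numbers.\<close>

lemma in_compl_space_iff:
  "p \<in> compl_space n \<longleftrightarrow> p \<in> U_space n \<and>
    (\<forall>i j. 1 \<le> i \<and> i < j \<and> j \<le> n \<longrightarrow> x_coord p i - y_coord n p i \<noteq> x_coord p j)"
proof -
  have "p \<in> linial_hyperplane n i j \<longleftrightarrow> p \<in> U_space n \<and> x_coord p i - y_coord n p i = x_coord p j"
    for i j
    by (auto simp: linial_hyperplane_def)
  then show ?thesis
    unfolding compl_space_def homogenized_linial_arrangement_def by blast
qed

section \<open>Arcs and sign conditions\<close>

lemma ascent_mem_region_tournament:
  assumes "i < j"
  shows "(i, j) \<in> region_tournament n R \<longleftrightarrow>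
    1 \<le> i \<and> j \<le> n \<and> (\<forall>p\<in>R. x_coord p i - y_coord n p i > x_coord p j)"
  using assms by (auto simp: region_tournament_def)

lemma descent_mem_region_tournament:
  assumes "i < j"
  shows "(j, i) \<in> region_tournament n R \<longleftrightarrow>
    1 \<le> i \<and> j \<le> n \<and> (\<forall>p\<in>R. x_coord p i - y_coord n p i < x_coord p j)"
  using assms by (auto simp: region_tournament_def)

lemmas mem_region_tournament = ascent_mem_region_tournament descent_mem_region_tournament

lemma region_tournament_subset:
  "region_tournament n R \<subseteq> {(i, j). i \<in> {1..n} \<and> j \<in> {1..n} \<and> i \<noteq> j}"
  by (auto simp: region_tournament_def)

lemma tournament_point:
  assumes "p \<in> compl_space n"
  shows "tournament n (region_tournament n {p})"
  unfolding tournament_def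
proof (intro conjI ballI impI region_tournament_subset)
  fix i j assume "i \<in> {1..n}" "j \<in> {1..n}" "i \<noteq> j"
  then show "(i, j) \<in> region_tournament n {p} \<longleftrightarrow> (j, i) \<notin> region_tournament n {p}"
    using assms unfolding in_compl_space_iff
    by (cases i j rule: linorder_cases) (force simp: mem_region_tournament)+
qed

lemma tournament_subset:
  "tournament n T \<Longrightarrow> T \<subseteq> {(i, j). i \<in> {1..n} \<and> j \<in> {1..n} \<and> i \<noteq> j}"
  unfolding tournament_def by (rule conjunct1)

lemma tournament_swap:
  assumes "tournament n T" "i \<in> {1..n}" "j \<in> {1..n}" "i \<noteq> j"
  shows "(i, j) \<in> T \<longleftrightarrow> (j, i) \<notin> T"
  using assms(1)[unfolded tournament_def, THEN conjunct2, rule_format, OF assms(2-4)] .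

lemma tournament_eqI:
  assumes "tournament n T" "tournament n T'"
    and "\<And>i j. 1 \<le> i \<Longrightarrow> i < j \<Longrightarrow> j \<le> n \<Longrightarrow> (i, j) \<in> T \<longleftrightarrow> (i, j) \<in> T'"
  shows "T = T'"
proof -
  have "(i, j) \<in> T \<longleftrightarrow> (i, j) \<in> T'" for i j
  proof (cases "i \<in> {1..n} \<and> j \<in> {1..n} \<and> i \<noteq> j")
    case True
    then have *: "i \<in> {1..n}" "j \<in> {1..n}" "i \<noteq> j"
      by auto
    show ?thesis
    proof (cases "i < j")
      case True
      then show ?thesis using assms(3) * by simp
    next
      case False
      then have "(j, i) \<in> T \<longleftrightarrow> (j, i) \<in> T'"
        using assms(3) * by simp
      then show ?thesis
        using tournament_swap[OF assms(1) *] tournament_swap[OF assms(2) *] by blast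
    qed
  next
    case False
    then show ?thesis
      using tournament_subset[OF assms(1)] tournament_subset[OF assms(2)] by blast
  qed
  then show ?thesis by auto
qed

section \<open>Signs are constant on a region and determine it\<close>

lemma continuous_on_shifted_diff:
  "continuous_on A (\<lambda>p. x_coord p i - y_coord n p i - x_coord p j)"
proof -
  have "continuous_on A (\<lambda>p. p k)" for k
    by (rule continuous_on_subset[OF continuous_on_product_coordinates]) simp
  then show ?thesis
    unfolding x_coord_def y_coord_def by (intro continuous_on_diff)
qed

lemma connected_real_sign:
  fixes f :: "'a::topological_space \<Rightarrow> real"
  assumes "connected S" "continuous_on S f" "\<And>x. x \<in> S \<Longrightarrow> f x \<noteq> 0" "x \<in> S" "y \<in> S" "f x > 0"
  shows "f y > 0"
proof (rule ccontr)
  assume "\<not> f y > 0"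
  moreover have "connected (f ` S)"
    using assms by (simp add: connected_continuous_image)
  ultimately have "0 \<in> f ` S"
    using connectedD_interval[of "f ` S" "f y" "f x" 0] assms(4-6) by simp
  then show False using assms(3) by (metis imageE)
qed

text \<open>Each difference z_i - x_j is continuous and never zero on the connected set
  \<open>R\<close>, so its sign can be tested at a single point. From here on tournaments are
  studied for singletons \<open>{p}\<close>.\<close>

lemma region_tournament_eq_point:
  assumes "R \<in> regions n" "p \<in> R"
  shows "region_tournament n R = region_tournament n {p}"
proof -
  let ?f = "\<lambda>i j p. x_coord p i - y_coord n p i - x_coord p j"
  have nz: "?f i j q \<noteq> 0" if "1 \<le> i" "i < j" "j \<le> n" "q \<in> R" for i j q
    using region_subset[OF assms(1)] that by (force simp: in_compl_space_iff)
  have sgn: "?f i j q > 0 \<longleftrightarrow> ?f i j p > 0" if "1 \<le> i" "i < j" "j \<le> n" "q \<in> R" for i j q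
    using connected_real_sign[OF region_connected[OF assms(1)] continuous_on_shifted_diff nz]
      that assms(2) by blast
  have gt: "(\<forall>q\<in>R. x_coord q i - y_coord n q i > x_coord q j)
      \<longleftrightarrow> x_coord p i - y_coord n p i > x_coord p j"
    and lt: "(\<forall>q\<in>R. x_coord q i - y_coord n q i < x_coord q j)
      \<longleftrightarrow> x_coord p i - y_coord n p i < x_coord p j" if "1 \<le> i" "i < j" "j \<le> n" for i j
    using sgn[OF that] nz[OF that] assms(2) by (smt (verit))+
  show ?thesis
    unfolding region_tournament_def using gt lt by fastforce
qed

lemma between_iff_endpoint:
  fixes a b c d t :: real
  assumes "a < b \<longleftrightarrow> c < d" "a \<noteq> b" "c \<noteq> d" "0 \<le> t" "t \<le> 1"
  shows "(1 - t) * a + t * c \<noteq> (1 - t) * b + t * d"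
proof (cases "a < b")
  case True
  then have "(1 - t) * (b - a) + t * (d - c) > 0"
    using assms by (cases "t = 0") (auto intro!: add_nonneg_pos)
  then show ?thesis by (simp add: algebra_simps)
next
  case False
  then have "(1 - t) * (a - b) + t * (c - d) > 0"
    using assms by (cases "t = 0") (auto intro!: add_nonneg_pos)
  then show ?thesis by (simp add: algebra_simps)
qed

text \<open>The numbers z_i and x_j are linear in the point, so a sign condition shared by both
  endpoints holds along the whole segment. This is what joins two regions with the same
  tournament.\<close>

lemma segment_subset_compl_space:
  assumes p: "p \<in> compl_space n" and q: "q \<in> compl_space n"
    and eq: "region_tournament n {p} = region_tournament n {q}"
    and t: "0 \<le> t" "t \<le> 1"
  shows "(\<lambda>k. (1 - t) * p k + t * q k) \<in> compl_space n"
proof -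
  let ?r = "\<lambda>k. (1 - t) * p k + t * q k"
  have x: "x_coord ?r i = (1 - t) * x_coord p i + t * x_coord q i" for i
    by (simp add: x_coord_def)
  have z: "x_coord ?r i - y_coord n ?r i =
      (1 - t) * (x_coord p i - y_coord n p i) + t * (x_coord q i - y_coord n q i)" for i
    by (simp add: x_coord_def y_coord_def algebra_simps)
  have "x_coord ?r i - y_coord n ?r i \<noteq> x_coord ?r j" if ij: "1 \<le> i" "i < j" "j \<le> n" for i j
    unfolding z unfolding x
  proof (rule between_iff_endpoint[OF _ _ _ t])
    have "(j, i) \<in> region_tournament n {p} \<longleftrightarrow> (j, i) \<in> region_tournament n {q}"
      using eq by simp
    then show "x_coord p i - y_coord n p i < x_coord p j \<longleftrightarrow>
        x_coord q i - y_coord n q i < x_coord q j"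
      using ij by (simp add: mem_region_tournament)
  qed (use p q ij in \<open>auto simp: in_compl_space_iff\<close>)
  moreover have "?r \<in> U_space n"
    using p q by (simp add: in_compl_space_iff U_space_def topspace_Euclidean_space x
        sum.distrib flip: sum_distrib_left)
  ultimately show ?thesis by (simp add: in_compl_space_iff)
qed

lemma region_tournament_inj: "inj_on (region_tournament n) (regions n)"
proof (rule inj_onI)
  fix R S assume R: "R \<in> regions n" and S: "S \<in> regions n"
    and eq: "region_tournament n R = region_tournament n S"
  obtain p q where p: "p \<in> R" and q: "q \<in> S"
    using region_nonempty R S by blast
  let ?g = "\<lambda>t k. (1 - t) * p k + t * q k"
  have "continuous_on {0..1::real} ?g"
    by (intro continuous_on_coordinatewise_then_product continuous_intros)
  then have "connected (?g ` {0..1})"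
    by (rule connected_continuous_image) simp
  moreover have "?g ` {0..1} \<subseteq> compl_space n"
  proof (rule image_subsetI, rule segment_subset_compl_space)
    show "region_tournament n {p} = region_tournament n {q}"
      using eq region_tournament_eq_point[OF R p] region_tournament_eq_point[OF S q] by simp
  qed (use p q region_subset[OF R] region_subset[OF S] in auto)
  moreover have "p \<in> ?g ` {0..1}" "q \<in> ?g ` {0..1}"
    by (auto intro: image_eqI[of _ _ 0] image_eqI[of _ _ 1])
  ultimately show "R = S"
    using regions_eqI[OF R S p q] by blast
qed

section \<open>Tournaments of points are alternation acyclic\<close>

lemma cycle_arc_periodic: "cycle_arc c (i + length c) = cycle_arc c i"
  by (simp add: cycle_arc_def flip: add_Suc)

lemma alternation_acyclic_point: "alternation_acyclic (region_tournament n {p})"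
  unfolding alternation_acyclic_def
proof (rule notI, elim exE conjE)
  fix c assume c: "directed_cycle (region_tournament n {p}) c" and alt: "alternating c"
  \<comment> \<open>The value compared by the \<open>i\<close>-th arc at its start: z for an ascent,
    x for a descent. As the next arc is of the other type, the value at the end of this arc is
    exactly \<open>w (Suc i)\<close>.\<close>
  define w where "w i = (let a = cycle_arc c i in
      if ascent a then x_coord p (fst a) - y_coord n p (fst a) else x_coord p (fst a))" for i
  have step: "w (Suc i) < w i" if "i < length c" for i
  proof -
    have link: "fst (cycle_arc c (Suc i)) = snd (cycle_arc c i)"
      by (simp add: cycle_arc_def)
    have arc: "cycle_arc c i \<in> region_tournament n {p}"
      using c that by (simp add: directed_cycle_def)
    consider "ascent (cycle_arc c i)" "descent (cycle_arc c (Suc i))"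
      | "descent (cycle_arc c i)" "ascent (cycle_arc c (Suc i))"
      using alt \<open>i < length c\<close> by (auto simp: alternating_def)
    then show ?thesis
      using arc link
      by cases (cases "cycle_arc c i"; simp add: w_def Let_def ascent_def descent_def mem_region_tournament)+
  qed
  have le: "w (Suc i) < w 0" if "i < length c" for i
    using that by (induction i) (use step in \<open>force+\<close>)
  \<comment> \<open>The strict drops add up around the cycle, but index \<open>length c\<close>
    denotes the first arc again.\<close>
  have "w (length c) < w 0"
    using le[of "length c - 1"] c by (simp add: directed_cycle_def)
  moreover have "w (length c) = w 0"
    using cycle_arc_periodic[of c 0] by (simp add: w_def)
  ultimately show False by simp
qed

section \<open>Realizing alternation acyclic tournaments\<close>

lemma no_alternating_4_cycle:
  assumes "alternation_acyclic T"
    and "(a, b) \<in> T" "(b, c) \<in> T" "(c, d) \<in> T" "(d, a) \<in> T"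
    and "a \<noteq> c" "b \<noteq> d" "a < b" "c < b" "c < d" "a < d"
  shows False
proof -
  have cases: "i = 0 \<or> i = 1 \<or> i = 2 \<or> i = 3" if "i < length [a, b, c, d]" for i
    using that by auto
  have len: "length [a, b, c, d] = 4"
    by simp
  \<comment> \<open>Index 2 appears in both spellings because it arises as an index and as a
    successor; index 4 wraps around to the first arc.\<close>
  have arcs: "cycle_arc [a, b, c, d] 0 = (a, b)" "cycle_arc [a, b, c, d] (Suc 0) = (b, c)"
    "cycle_arc [a, b, c, d] (Suc (Suc 0)) = (c, d)" "cycle_arc [a, b, c, d] 2 = (c, d)"
    "cycle_arc [a, b, c, d] 3 = (d, a)" "cycle_arc [a, b, c, d] 4 = (a, b)"
    unfolding cycle_arc_def len by (simp_all flip: numeral_2_eq_2)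
  have "cycle_arc [a, b, c, d] i \<in> T" if "i < length [a, b, c, d]" for i
    using cases[OF that] assms(2-5) arcs by auto
  then have "directed_cycle T [a, b, c, d]"
    using assms(6-11) unfolding directed_cycle_def by simp
  moreover have
    "ascent (cycle_arc [a, b, c, d] i) \<and> descent (cycle_arc [a, b, c, d] (Suc i)) \<or>
     descent (cycle_arc [a, b, c, d] i) \<and> ascent (cycle_arc [a, b, c, d] (Suc i))"
    if "i < length [a, b, c, d]" for i
    using cases[OF that] assms(8-11) by (elim disjE) (simp_all add: arcs ascent_def descent_def)
  then have "alternating [a, b, c, d]"
    unfolding alternating_def by blast
  ultimately show False
    using assms(1) unfolding alternation_acyclic_def by blast
qed

text \<open>All x_j are present from the start, while only the z_i with \<open>m \<le> i\<close> are
  constrained; lowering \<open>m\<close> by one adds one z.\<close>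

definition realizes :: "nat \<Rightarrow> nat \<Rightarrow> (nat \<times> nat) set \<Rightarrow> (nat \<Rightarrow> real) \<Rightarrow> (nat \<Rightarrow> real) \<Rightarrow> bool"
  where "realizes n m T x z \<longleftrightarrow> (\<forall>i j. m \<le> i \<and> i < j \<and> j \<le> n \<longrightarrow>
    ((i, j) \<in> T \<longrightarrow> x j < z i) \<and> ((j, i) \<in> T \<longrightarrow> z i < x j))"

lemma realizes_extend:
  assumes asym: "\<And>i j. (i, j) \<in> T \<Longrightarrow> (j, i) \<notin> T" and acyc: "alternation_acyclic T"
    and total: "\<And>j. m < j \<Longrightarrow> j \<le> n \<Longrightarrow> (m, j) \<in> T \<or> (j, m) \<in> T"
    and real: "realizes n (Suc m) T x z"
  shows "\<exists>x' z'. realizes n m T x' z'"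
proof -
  \<comment> \<open>A strict bound on all |x_j|: shifted values x_j - 2K lie below -K and unshifted
    ones above it, so z_m = -K separates them. Including index 0 keeps the set nonempty and gives
    \<open>K > 0\<close>.\<close>
  define K where "K = Max ((\<lambda>j. \<bar>x j\<bar>) ` {..n}) + 1"
  have K: "\<bar>x j\<bar> < K" if "j \<le> n" for j
  proof -
    have "\<bar>x j\<bar> \<le> Max ((\<lambda>j. \<bar>x j\<bar>) ` {..n})"
      using that by (intro Max_ge) auto
    then show ?thesis by (simp add: K_def)
  qed
  \<comment> \<open>A low \<open>c\<close> has every x_j required below z_c shifted, so z_c can be
    shifted too; conditions z_c < x_j then survive because x_j moves by at most 2K. If
    \<open>c\<close> is not low, z_c stays, and only conditions z_c < x_b with shifted x_b are in
    danger.\<close>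
  define low where "low c \<longleftrightarrow> (\<forall>j. c < j \<and> j \<le> n \<and> (c, j) \<in> T \<longrightarrow> (m, j) \<in> T)" for c
  define x' where "x' j = (if (m, j) \<in> T then x j - 2 * K else x j)" for j
  define z' where "z' c = (if c = m then - K else if low c then z c - 2 * K else z c)" for c
  have "K > 0"
    using K[of 0] by linarith
  \<comment> \<open>Such a \<open>b\<close> is impossible: a witness \<open>d\<close> against
    \<open>low c\<close> has \<open>d \<rightarrow> m\<close>, and \<open>m \<rightarrow> b
    \<rightarrow> c \<rightarrow> d \<rightarrow> m\<close> alternates, since \<open>m\<close> and
    \<open>c\<close> both lie below \<open>b\<close> and \<open>d\<close>.\<close>
  have cross: "(m, b) \<notin> T" if c: "m < c" "\<not> low c" and b: "c < b" "b \<le> n" "(b, c) \<in> T" for b c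
  proof
    assume mb: "(m, b) \<in> T"
    obtain d where d: "c < d" "d \<le> n" "(c, d) \<in> T" "(m, d) \<notin> T"
      using c(2) by (auto simp: low_def)
    then have "(d, m) \<in> T"
      using total[of d] c by auto
    then show False
      using no_alternating_4_cycle[OF acyc mb b(3) d(3)] c b d mb by auto
  qed
  have "realizes n m T x' z'"
    unfolding realizes_def
  proof (intro allI impI)
    fix i j assume ij: "m \<le> i \<and> i < j \<and> j \<le> n"
    show "((i, j) \<in> T \<longrightarrow> x' j < z' i) \<and> ((j, i) \<in> T \<longrightarrow> z' i < x' j)"
    proof (cases "i = m")
      case True
      have "\<bar>x j\<bar> < K" using K ij by simp
      then show ?thesis using True asym[of m j] by (auto simp: x'_def z'_def)
    next
      case False
      then have "((i, j) \<in> T \<longrightarrow> x j < z i) \<and> ((j, i) \<in> T \<longrightarrow> z i < x j)"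
        using real ij by (simp add: realizes_def)
      moreover have "(m, j) \<in> T" if "low i" "(i, j) \<in> T"
        using that ij by (auto simp: low_def)
      moreover have "(m, j) \<notin> T" if "\<not> low i" "(j, i) \<in> T"
        using cross[of i j] that ij False by auto
      ultimately show ?thesis
        using False \<open>K > 0\<close> by (auto simp: x'_def z'_def)
    qed
  qed
  then show ?thesis by blast
qed

lemma alternation_acyclic_realizable:
  assumes T: "tournament n T" and acyc: "alternation_acyclic T"
  obtains x z where "realizes n 1 T x z"
proof -
  have "\<exists>x z. realizes n 1 T x z"
  \<comment> \<open>Downward induction from \<open>Suc n\<close>, where no pair is
    constrained.\<close>
  proof (rule inc_induct[of 1 "Suc n"])
    show "\<exists>x z. realizes n (Suc n) T x z"
      by (auto simp: realizes_def)
    fix m assume m: "1 \<le> m" "\<exists>x z. realizes n (Suc m) T x z"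
    have "(j, i) \<notin> T" if "(i, j) \<in> T" for i j
      using tournament_subset[OF T] tournament_swap[OF T, of i j] that by blast
    moreover have "(m, j) \<in> T \<or> (j, m) \<in> T" if "m < j" "j \<le> n" for j
      using tournament_swap[OF T, of m j] m(1) that by auto
    ultimately show "\<exists>x z. realizes n m T x z"
      using realizes_extend[OF _ acyc] m(2) by blast
  qed simp
  then show thesis using that by blast
qed

lemma realizes_imp_point:
  assumes n: "n \<ge> 1" and T: "tournament n T" and real: "realizes n 1 T x z"
  obtains p where "p \<in> compl_space n" "region_tournament n {p} = T"
proof -
  \<comment> \<open>Subtracting the mean from all x and z makes the x coordinates sum to zero and
    preserves every comparison; the differences y_i = x_i - z_i do not change.\<close>
  define s where "s = (\<Sum>i = 1..n. x i) / n"
  \<comment> \<open>Positions count from 0, hence the shifts by one. There is no y_n, but z_i is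
    only needed for \<open>i < j \<le> n\<close>; the zeros beyond put \<open>p\<close> into
    \<open>Euclidean_space\<close>.\<close>
  define p where "p k = (if k < n then x (k + 1) - s
      else if k < 2 * n - 1 then x (k - n + 1) - z (k - n + 1) else 0)" for k
  have x: "x_coord p i = x i - s" if "1 \<le> i" "i \<le> n" for i
    using that by (auto simp: x_coord_def p_def)
  have z: "x_coord p i - y_coord n p i = z i - s" if "1 \<le> i" "i < n" for i
    using that by (auto simp: x y_coord_def p_def)
  have "(\<Sum>i = 1..n. x_coord p i) = (\<Sum>i = 1..n. x i - s)"
    by (intro sum.cong) (auto simp: x)
  also have "\<dots> = 0"
    using n by (simp add: sum_subtractf s_def)
  finally have U: "p \<in> U_space n"
    by (auto simp: U_space_def topspace_Euclidean_space p_def)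
  have arc: "(i, j) \<in> T \<and> x j < z i \<or> (i, j) \<notin> T \<and> z i < x j"
    if "1 \<le> i" "i < j" "j \<le> n" for i j
  proof -
    have "(i, j) \<in> T \<longleftrightarrow> (j, i) \<notin> T"
      by (rule tournament_swap[OF T]) (use that in auto)
    then show ?thesis using real that unfolding realizes_def by blast
  qed
  have p: "p \<in> compl_space n"
    unfolding in_compl_space_iff
  proof (intro conjI allI impI U)
    fix i j :: nat assume ij: "1 \<le> i \<and> i < j \<and> j \<le> n"
    then have "x j \<noteq> z i"
      using arc[of i j] by auto
    then show "x_coord p i - y_coord n p i \<noteq> x_coord p j"
      using z[of i] x[of j] ij by simp
  qed
  moreover have "region_tournament n {p} = T"
  proof (rule tournament_eqI[OF tournament_point[OF p] T])
    fix i j :: nat assume ij: "1 \<le> i" "i < j" "j \<le> n"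
    then have "(i, j) \<in> region_tournament n {p} \<longleftrightarrow> x j < z i"
      using z[of i] x[of j] by (simp add: ascent_mem_region_tournament)
    then show "(i, j) \<in> region_tournament n {p} \<longleftrightarrow> (i, j) \<in> T"
      using arc[OF ij] by auto
  qed
  ultimately show thesis using that by blast
qed

theorem theorem4p3:
  fixes n :: nat
  assumes "n \<ge> 1"
  shows "bij_betw (region_tournament n) (regions n)
           {T. tournament n T \<and> alternation_acyclic T}"
  unfolding bij_betw_def
proof (intro conjI region_tournament_inj equalityI subsetI)
  fix T assume "T \<in> region_tournament n ` regions n"
  then obtain R where R: "R \<in> regions n" and T: "T = region_tournament n R"
    by blast
  then obtain p where p: "p \<in> R"
    using region_nonempty by blast
  then have "p \<in> compl_space n"
    using region_subset R by blast
  then show "T \<in> {T. tournament n T \<and> alternation_acyclic T}"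
    using T region_tournament_eq_point[OF R p] tournament_point alternation_acyclic_point by simp
next
  fix T assume "T \<in> {T. tournament n T \<and> alternation_acyclic T}"
  then have T: "tournament n T" "alternation_acyclic T"
    by auto
  obtain x z where "realizes n 1 T x z"
    using alternation_acyclic_realizable[OF T] .
  then obtain p where p: "p \<in> compl_space n" "region_tournament n {p} = T"
    using realizes_imp_point[OF assms T(1)] by blast
  then obtain R where "R \<in> regions n" "p \<in> R"
    using ex_region by blast
  then show "T \<in> region_tournament n ` regions n"
    using p region_tournament_eq_point by blast
qed

end
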